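(* Let $D$ be the formal derivative with respect to the context-free grammar $z \rightarrow xyz,\ x \rightarrow xy,\ y \rightarrow xy$. For every integer $n\geq 1$, \[ D^n(z)=\sum_{k=1}^{n}\sum_{m=k}^{n} C(n,k,m)\,x^m y^{k+n-m} z, \] where $C(n,k,m)$ is the number of partitions of $[n]$ into $k$ lists having exactly $m$ ascents.
   Context: The formal derivative $D$ with respect to a grammar is the unique linear operator on polynomials in the letters that sends each letter to its image under the grammar's rule and satisfies the Leibniz rule $D(uv)=D(u)v+uD(v)$. A partition of $[n]=\{1,\ldots,n\}$ into lists is a set partition of $[n]$ in which the elements of each block are linearly ordered. The number of ascents of such a partition is computed as follows: write each list $\sigma_1\sigma_2\cdots\sigma_j$ as $0\sigma_1\sigma_2\cdots\sigma_j0$ and count the positions $i\in\{0,\ldots,j-1\}$ with $\sigma_i<\sigma_{i+1}$ (where $\sigma_0=0$); the number of ascents of the partition is the sum of these counts over all its lists (so each list contributes at least one ascent). *)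

theory Defs
  imports Complex_Main "HOL-Library.Poly_Mapping" "HOL-Library.Disjoint_Sets"
begin

section \<open>Grammars and their formal derivatives\<close>

text \<open>
  A polynomial in letters of type \<open>'v\<close> is a finitely supported map from exponent vectors
  to coefficients, so products are convolution products.
\<close>

type_synonym ('v, 'a) polynomial = "('v \<Rightarrow>\<^sub>0 nat) \<Rightarrow>\<^sub>0 'a"

type_synonym ('v, 'a) grammar = "'v \<Rightarrow> ('v, 'a) polynomial"

definition letter :: "'v \<Rightarrow> ('v, 'a::comm_ring_1) polynomial" where
  "letter v = Poly_Mapping.single (Poly_Mapping.single v 1) 1"

definition poly_scale :: "'a::comm_ring_1 \<Rightarrow> ('v, 'a) polynomial \<Rightarrow> ('v, 'a) polynomial" where
  "poly_scale c p = Poly_Mapping.single 0 c * p"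

definition is_formal_derivative ::
  "('v, 'a::comm_ring_1) grammar \<Rightarrow> (('v, 'a) polynomial \<Rightarrow> ('v, 'a) polynomial) \<Rightarrow> bool" where
  "is_formal_derivative G D \<longleftrightarrow>
     module_hom poly_scale poly_scale D \<and>
     (\<forall>v. D (letter v) = G v) \<and>
     (\<forall>p q. D (p * q) = D p * q + p * D q)"

definition formal_derivative ::
  "('v, 'a::comm_ring_1) grammar \<Rightarrow> ('v, 'a) polynomial \<Rightarrow> ('v, 'a) polynomial" where
  "formal_derivative G = (THE D. is_formal_derivative G D)"

text \<open>Existence and uniqueness, so that the description above denotes.\<close>

lemma poly_mapping_sum_single:
  fixes p :: "'k \<Rightarrow>\<^sub>0 'b::comm_monoid_add"
  shows "p = (\<Sum>k\<in>Poly_Mapping.keys p. Poly_Mapping.single k (Poly_Mapping.lookup p k))"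
  by (rule poly_mapping_eqI)
    (auto simp: lookup_sum lookup_single when_def sum.delta in_keys_iff)

lemma poly_mapping_add_induct:
  fixes p :: "'k \<Rightarrow>\<^sub>0 'b::comm_monoid_add"
  assumes "\<And>k b. P (Poly_Mapping.single k b)" and "\<And>p q. P p \<Longrightarrow> P q \<Longrightarrow> P (p + q)"
  shows "P p"
proof -
  have "P 0" using assms(1)[of _ 0] by simp
  have "P (\<Sum>k\<in>K. Poly_Mapping.single k (Poly_Mapping.lookup p k))" if "finite K" for K
    using that by (induction K) (auto simp: \<open>P 0\<close> assms)
  then show ?thesis using poly_mapping_sum_single[of p] by (metis finite_keys)
qed

lemma module_scale: "module (poly_scale :: 'a::comm_ring_1 \<Rightarrow> ('v, 'a) polynomial \<Rightarrow> _)"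
  by standard (simp_all add: poly_scale_def distrib_left distrib_right single_add mult_single
      flip: mult.assoc)

lemma formal_derivative_unique:
  assumes "is_formal_derivative G D" and "is_formal_derivative G E"
  shows "D = E"
proof
  interpret D: module_hom poly_scale poly_scale D using assms(1) by (simp add: is_formal_derivative_def)
  interpret E: module_hom poly_scale poly_scale E using assms(2) by (simp add: is_formal_derivative_def)
  have DL: "D (p * q) = D p * q + p * D q" and EL: "E (p * q) = E p * q + p * E q" for p q
    using assms by (simp_all add: is_formal_derivative_def)
  have v: "D (letter v) = E (letter v)" for v
    using assms by (simp add: is_formal_derivative_def)
  have one: "D 1 = 0" "E 1 = 0"
    using DL[of 1 1] EL[of 1 1] by simp_all
  have mult: "D (p * q) = E (p * q)" if "D p = E p" "D q = E q" for p q
    using that by (simp add: DL EL)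
  have pow: "D (letter v ^ n) = E (letter v ^ n)" for v n
    by (induction n) (simp_all add: one v mult)
  have pow_eq: "(letter v :: ('a, 'b) polynomial) ^ n
      = Poly_Mapping.single (Poly_Mapping.single v n) 1" for v n
    by (induction n) (simp_all add: letter_def mult_single flip: single_add)
  have mon: "D (Poly_Mapping.single m 1) = E (Poly_Mapping.single m 1)" for m
  proof (induction m rule: poly_mapping_add_induct)
    case (1 k b)
    then show ?case using pow[of k b] by (simp add: pow_eq)
  next
    case (2 m n)
    then show ?case
      using mult[of "Poly_Mapping.single m 1" "Poly_Mapping.single n 1"] by (simp add: mult_single)
  qed
  show "D p = E p" for p
  proof (induction p rule: poly_mapping_add_induct)
    case (1 m c)
    have "Poly_Mapping.single m c = poly_scale c (Poly_Mapping.single m 1)"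
      by (simp add: poly_scale_def mult_single)
    then show ?case by (simp add: D.scale E.scale mon)
  next
    case (2 p q)
    then show ?case by (simp add: D.add E.add)
  qed
qed

lemma formal_derivative_exists:
  fixes G :: "('v, 'a::comm_ring_1) grammar"
  shows "\<exists>D. is_formal_derivative G D"
proof -
  define d :: "('v \<Rightarrow>\<^sub>0 nat) \<Rightarrow> ('v, 'a) polynomial" where
    "d m = (\<Sum>v\<in>Poly_Mapping.keys m. Poly_Mapping.single (m - Poly_Mapping.single v 1)
              (of_nat (Poly_Mapping.lookup m v)) * G v)" for m
  define D where "D p = (\<Sum>m\<in>Poly_Mapping.keys p. poly_scale (Poly_Mapping.lookup p m) (d m))" for p
  interpret module "poly_scale :: 'a \<Rightarrow> ('v, 'a) polynomial \<Rightarrow> _" by (rule module_scale)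
  have d_eq: "d m = (\<Sum>v\<in>K. Poly_Mapping.single (m - Poly_Mapping.single v 1)
              (of_nat (Poly_Mapping.lookup m v)) * G v)" if "finite K" "Poly_Mapping.keys m \<subseteq> K" for m K
    unfolding d_def using that by (intro sum.mono_neutral_left) (auto simp: in_keys_iff)
  have D_eq: "D p = (\<Sum>m\<in>K. poly_scale (Poly_Mapping.lookup p m) (d m))" if "finite K" "Poly_Mapping.keys p \<subseteq> K" for p K
    unfolding D_def using that by (intro sum.mono_neutral_left) (auto simp: in_keys_iff)
  have d_add: "d (a + b) = d a * Poly_Mapping.single b 1 + Poly_Mapping.single a 1 * d b" for a b
  proof -
    let ?K = "Poly_Mapping.keys a \<union> Poly_Mapping.keys b"
    have shift: "Poly_Mapping.single (a + b - Poly_Mapping.single v 1) (of_nat (Poly_Mapping.lookup a v))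
        = Poly_Mapping.single (a - Poly_Mapping.single v 1) (of_nat (Poly_Mapping.lookup a v))
          * Poly_Mapping.single b (1::'a)" for a b :: "'v \<Rightarrow>\<^sub>0 nat" and v
    proof (cases "Poly_Mapping.lookup a v = 0")
      case False
      then have "a + b - Poly_Mapping.single v 1 = (a - Poly_Mapping.single v 1) + b"
        by (intro poly_mapping_eqI) (auto simp: lookup_add lookup_minus lookup_single when_def)
      then show ?thesis by (simp add: mult_single)
    qed simp
    have shift': "Poly_Mapping.single (a + b - Poly_Mapping.single v 1) (of_nat (Poly_Mapping.lookup b v))
        = Poly_Mapping.single a (1::'a)
          * Poly_Mapping.single (b - Poly_Mapping.single v 1) (of_nat (Poly_Mapping.lookup b v))" for v
      using shift[where a = b and b = a and v = v]
      by (simp only: add.commute[of b a] mult.commute[of "Poly_Mapping.single a 1"])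
    have "d (a + b) = (\<Sum>v\<in>?K. Poly_Mapping.single (a + b - Poly_Mapping.single v 1)
              (of_nat (Poly_Mapping.lookup (a + b) v)) * G v)"
      by (rule d_eq) (use keys_add[of a b] in auto)
    also have "\<dots> = (\<Sum>v\<in>?K. Poly_Mapping.single (a - Poly_Mapping.single v 1)
              (of_nat (Poly_Mapping.lookup a v)) * G v * Poly_Mapping.single b 1
            + Poly_Mapping.single a 1 * (Poly_Mapping.single (b - Poly_Mapping.single v 1)
              (of_nat (Poly_Mapping.lookup b v)) * G v))"
    proof (rule sum.cong[OF refl])
      fix v
      show "Poly_Mapping.single (a + b - Poly_Mapping.single v 1)
              (of_nat (Poly_Mapping.lookup (a + b) v)) * G v
        = Poly_Mapping.single (a - Poly_Mapping.single v 1)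
              (of_nat (Poly_Mapping.lookup a v)) * G v * Poly_Mapping.single b 1
            + Poly_Mapping.single a 1 * (Poly_Mapping.single (b - Poly_Mapping.single v 1)
              (of_nat (Poly_Mapping.lookup b v)) * G v)"
        by (simp only: lookup_add of_nat_add single_add distrib_right shift shift' mult.assoc
            mult.commute[of "G v"])
    qed
    also have "\<dots> = d a * Poly_Mapping.single b 1 + Poly_Mapping.single a 1 * d b"
      by (simp add: sum.distrib sum_distrib_left sum_distrib_right d_eq[of ?K a] d_eq[of ?K b])
    finally show ?thesis .
  qed
  have D_single: "D (Poly_Mapping.single m c) = poly_scale c (d m)" for m c
    by (simp add: D_def)
  have D_add: "D (p + q) = D p + D q" for p q
  proof -
    let ?K = "Poly_Mapping.keys p \<union> Poly_Mapping.keys q"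
    have "D (p + q) = (\<Sum>m\<in>?K. poly_scale (Poly_Mapping.lookup (p + q) m) (d m))"
      by (rule D_eq) (use keys_add[of p q] in auto)
    then show ?thesis
      by (simp add: D_eq[of ?K p] D_eq[of ?K q] lookup_add scale_left_distrib sum.distrib)
  qed
  have D_scale: "D (poly_scale c p) = poly_scale c (D p)" for c p
  proof (induction p rule: poly_mapping_add_induct)
    case (1 m b)
    have "poly_scale c (Poly_Mapping.single m b) = Poly_Mapping.single m (c * b)"
      by (simp add: poly_scale_def mult_single)
    then show ?case by (simp add: D_single)
  next
    case (2 p q)
    then show ?case by (simp add: scale_right_distrib D_add)
  qed
  have "module_hom poly_scale poly_scale D"
    by unfold_locales (simp_all add: D_add D_scale)
  moreover have "D (letter v) = G v" for v
    by (simp add: letter_def D_single d_def)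
  moreover have "D (p * q) = D p * q + p * D q" for p q
  proof (induction p rule: poly_mapping_add_induct)
    case (1 a c)
    show ?case
    proof (induction q rule: poly_mapping_add_induct)
      case (1 b e)
      have "Poly_Mapping.single m r = poly_scale r (Poly_Mapping.single m 1)"
        for m :: "'v \<Rightarrow>\<^sub>0 nat" and r :: 'a
        by (simp add: poly_scale_def mult_single)
      note s = this[of a c] this[of b e]
      have "D (Poly_Mapping.single a c * Poly_Mapping.single b e)
          = poly_scale (c * e) (d a * Poly_Mapping.single b 1 + Poly_Mapping.single a 1 * d b)"
        by (simp add: mult_single D_single d_add)
      also have "\<dots> = poly_scale c (d a) * Poly_Mapping.single b e
          + Poly_Mapping.single a c * poly_scale e (d b)"
        unfolding s
        unfolding scale_scale[symmetric]
        by (simp add: poly_scale_def algebra_simps)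
      finally show ?case by (simp add: D_single)
    next
      case (2 p q)
      then show ?case by (simp add: D_add algebra_simps)
    qed
  next
    case (2 p q)
    then show ?case by (simp add: D_add algebra_simps)
  qed
  ultimately have "is_formal_derivative G D"
    by (simp add: is_formal_derivative_def)
  then show ?thesis by (rule exI[where x = D])
qed

lemma is_formal_derivative_formal_derivative: "is_formal_derivative G (formal_derivative G)"
proof -
  have "\<exists>!D. is_formal_derivative G D"
  proof (rule ex_ex1I)
    show "\<exists>D. is_formal_derivative G D" by (rule formal_derivative_exists)
  qed (rule formal_derivative_unique)
  then show ?thesis
    unfolding formal_derivative_def by (rule theI'[where P = "is_formal_derivative G"])
qed


section \<open>The grammar \<open>z \<rightarrow> xyz\<close>, \<open>x \<rightarrow> xy\<close>, \<open>y \<rightarrow> xy\<close>\<close>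

datatype xyz = X | Y | Z

fun lists_grammar :: "(xyz, 'a::comm_ring_1) grammar" where
  "lists_grammar Z = letter X * letter Y * letter Z"
| "lists_grammar X = letter X * letter Y"
| "lists_grammar Y = letter X * letter Y"


section \<open>Partitions into lists\<close>

text \<open>
  A set of duplicate-free lists whose underlying sets are the blocks of a set partition of
  \<open>{1..n}\<close>; injectivity of \<^const>\<open>set\<close> says that each block carries only one order.
\<close>

definition list_partitions :: "nat \<Rightarrow> nat list set set" where
  "list_partitions n =
     {P. partition_on {1..n} (set ` P) \<and> inj_on set P \<and> (\<forall>\<sigma>\<in>P. distinct \<sigma>)}"

definition list_ascents :: "nat list \<Rightarrow> nat" where
  "list_ascents \<sigma> =
     (let w = 0 # \<sigma> @ [0] in card {i \<in> {0..<length \<sigma>}. w ! i < w ! (i + 1)})"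

definition ascents :: "nat list set \<Rightarrow> nat" where
  "ascents P = (\<Sum>\<sigma>\<in>P. list_ascents \<sigma>)"

definition C :: "nat \<Rightarrow> nat \<Rightarrow> nat \<Rightarrow> nat" where
  "C n k m = card {P \<in> list_partitions n. card P = k \<and> ascents P = m}"

lemma finite_list_partitions: "finite (list_partitions n)"
proof -
  have "list_partitions n \<subseteq> Pow {\<sigma>. set \<sigma> \<subseteq> {1..n} \<and> distinct \<sigma>}"
    by (auto simp: list_partitions_def partition_on_def)
  then show ?thesis
    by (rule finite_subset) (simp add: finite_subset_distinct)
qed

lemma finite_in_list_partitions: "P \<in> list_partitions n \<Longrightarrow> finite P"
  unfolding list_partitions_def
  by (metis (no_types, lifting) finite_atLeastAtMost finite_elements finite_imageD mem_Collect_eq)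

end

theory Submission
  imports Defs
begin

text \<open>
  Give every gap of the word \<open>0 \<sigma> 0\<close> the weight \<open>x\<close> if it ascends and \<open>y\<close> otherwise, and give
  a partition into lists the product of the weights of its gaps. Inserting the new maximum
  \<open>n + 1\<close> into a gap, of either kind, replaces it by an ascent followed by a descent, which is
  the effect of the rules \<open>x \<rightarrow> xy\<close> and \<open>y \<rightarrow> xy\<close>; opening the new list \<open>0 (n + 1) 0\<close> is the
  effect of \<open>z \<rightarrow> xyz\<close>. By the Leibniz rule, \<open>D\<close> therefore sends the generating polynomial of
  the partitions of \<open>[n]\<close> to that of the partitions of \<open>[n + 1]\<close>.
\<close>

section \<open>Weights of words\<close>

text \<open>The letter \<open>a\<close> is the one preceding the word; the last gap is always a descent to \<open>0\<close>.\<close>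

fun word_weight :: "'r::comm_ring_1 \<Rightarrow> 'r \<Rightarrow> nat \<Rightarrow> nat list \<Rightarrow> 'r" where
  "word_weight x y a [] = y"
| "word_weight x y a (b # s) = (if a < b then x else y) * word_weight x y b s"

definition partition_weight :: "'r::comm_ring_1 \<Rightarrow> 'r \<Rightarrow> nat list set \<Rightarrow> 'r" where
  "partition_weight x y P = (\<Prod>\<sigma>\<in>P. word_weight x y 0 \<sigma>)"

section \<open>Inserting a letter into a word\<close>

definition insert_at :: "'a \<Rightarrow> nat \<Rightarrow> 'a list \<Rightarrow> 'a list" where
  "insert_at N i \<sigma> = take i \<sigma> @ N # drop i \<sigma>"

lemma insert_at_0 [simp]: "insert_at N 0 \<sigma> = N # \<sigma>"
  by (simp add: insert_at_def)

lemma insert_at_Suc_Cons [simp]: "insert_at N (Suc i) (b # s) = b # insert_at N i s"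
  by (simp add: insert_at_def)

lemma set_insert_at [simp]: "set (insert_at N i \<sigma>) = insert N (set \<sigma>)"
  unfolding insert_at_def by (metis append_take_drop_id list.simps(15) set_append Un_insert_right)

lemma distinct_insert_at: "distinct (insert_at N i \<sigma>) \<longleftrightarrow> distinct \<sigma> \<and> N \<notin> set \<sigma>"
proof -
  have "distinct (insert_at N i \<sigma>) \<longleftrightarrow> distinct (N # take i \<sigma> @ drop i \<sigma>)"
    unfolding insert_at_def by (auto simp del: append_take_drop_id)
  then show ?thesis by auto
qed

text \<open>As \<open>N\<close> occurs only once in the enlarged word, it marks where the word
  splits. The bounds matter because \<open>take\<close> and \<open>drop\<close> do not distinguish
  positions beyond the end.\<close>

lemma insert_at_inject:
  assumes "insert_at N i \<sigma> = insert_at N j \<tau>" "N \<notin> set \<sigma>" "N \<notin> set \<tau>"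
    and "i \<le> length \<sigma>" "j \<le> length \<tau>"
  shows "i = j \<and> \<sigma> = \<tau>"
proof -
  have "N \<notin> set (take i \<sigma>)" "N \<notin> set (take j \<tau>)"
    using assms(2,3) by (auto dest: in_set_takeD)
  moreover have "N \<notin> set (drop i \<sigma>)" "N \<notin> set (drop j \<tau>)"
    using assms(2,3) by (auto dest: in_set_dropD)
  ultimately have *: "take i \<sigma> = take j \<tau>" "drop i \<sigma> = drop j \<tau>"
    using assms(1) unfolding insert_at_def by (auto simp: append_Cons_eq_iff)
  have "i = j"
    using arg_cong[OF *(1), of length] assms(4,5) by simp
  moreover have "\<sigma> = \<tau>"
    using * by (metis append_take_drop_id)
  ultimately show ?thesis by simp
qed

lemma obtain_insert_at:
  assumes "N \<in> set \<tau>"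
  obtains \<sigma> i where "\<tau> = insert_at N i \<sigma>" "i \<le> length \<sigma>"
proof -
  obtain a b where "\<tau> = a @ N # b"
    using assms by (meson split_list)
  then have "\<tau> = insert_at N (length a) (a @ b)" by (simp add: insert_at_def)
  then show thesis by (rule that) simp
qed

section \<open>Word weights as monomials in the number of ascents\<close>

text \<open>The word has \<open>Suc (length s)\<close> gaps; each one that is not an ascent,
  including the final one before \<open>0\<close>, carries \<open>y\<close>. A general preceding
  letter \<open>a\<close> lets the induction move along the word.\<close>

lemma word_weight_eq:
  "word_weight x y a s =
     x ^ card {i \<in> {0..<length s}. (a # s @ [0]) ! i < (a # s @ [0]) ! (i + 1)} *
     y ^ (Suc (length s) - card {i \<in> {0..<length s}. (a # s @ [0]) ! i < (a # s @ [0]) ! (i + 1)})"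
proof (induction s arbitrary: a)
  case Nil
  then show ?case by simp
next
  case (Cons b s)
  let ?A = "\<lambda>a s. {i \<in> {0..<length s}. (a # s @ [0]) ! i < (a # s @ [0]) ! (i + 1)}"
  \<comment> \<open>Position \<open>0\<close> is the gap from \<open>a\<close> to \<open>b\<close>;
    the later gaps are those of \<open>b # s\<close>, shifted by one.\<close>
  have "?A a (b # s) = (if a < b then {0} else {}) \<union> Suc ` ?A b s"
  proof (rule set_eqI)
    fix i
    show "i \<in> ?A a (b # s) \<longleftrightarrow> i \<in> (if a < b then {0} else {}) \<union> Suc ` ?A b s"
      by (cases i) auto
  qed
  then have card: "card (?A a (b # s)) = (if a < b then 1 else 0) + card (?A b s)"
    by (auto simp: card_image card_insert_if)
  \<comment> \<open>This bound keeps the subtraction in the exponent of \<open>y\<close> exact when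
    the first gap is not an ascent and adds one to it.\<close>
  have "card (?A b s) \<le> card {0..<length s}"
    by (rule card_mono) auto
  then have "card (?A b s) \<le> length s" by simp
  then show ?case
    by (simp only: word_weight.simps Cons.IH card) (auto simp: Suc_diff_le)
qed

lemma list_ascents_le_length: "list_ascents \<sigma> \<le> length \<sigma>"
proof -
  have "list_ascents \<sigma> \<le> card {0..<length \<sigma>}"
    unfolding list_ascents_def Let_def by (rule card_mono) auto
  then show ?thesis by simp
qed

text \<open>The step from the leading \<open>0\<close> to the first letter always ascends.\<close>

lemma list_ascents_pos:
  assumes "\<sigma> \<noteq> []" "0 \<notin> set \<sigma>"
  shows "list_ascents \<sigma> \<ge> 1"
proof -
  have "0 \<in> {i \<in> {0..<length \<sigma>}. (0 # \<sigma> @ [0]) ! i < (0 # \<sigma> @ [0]) ! (i + 1)}"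
    using assms by (cases \<sigma>) auto
  then have "{i \<in> {0..<length \<sigma>}. (0 # \<sigma> @ [0]) ! i < (0 # \<sigma> @ [0]) ! (i + 1)} \<noteq> {}"
    by blast
  then show ?thesis
    unfolding list_ascents_def Let_def by (simp add: Suc_le_eq card_gt_0_iff)
qed

lemma word_weight_0:
  "word_weight x y 0 \<sigma> = x ^ list_ascents \<sigma> * y ^ (Suc (length \<sigma>) - list_ascents \<sigma>)"
  by (simp only: word_weight_eq list_ascents_def Let_def)


section \<open>Partitions into lists\<close>

text \<open>Nonempty lists with the same underlying set cannot be disjoint, so disjointness of
  different lists covers both the disjointness of the blocks and the injectivity of
  \<open>set\<close>.\<close>

lemma list_partitions_iff:
  "P \<in> list_partitions n \<longleftrightarrow>
     (\<forall>\<sigma>\<in>P. distinct \<sigma> \<and> \<sigma> \<noteq> []) \<and> (\<Union>\<sigma>\<in>P. set \<sigma>) = {1..n} \<and>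
     (\<forall>\<sigma>\<in>P. \<forall>\<tau>\<in>P. \<sigma> \<noteq> \<tau> \<longrightarrow> set \<sigma> \<inter> set \<tau> = {})"
    (is "_ \<longleftrightarrow> ?R")
proof
  assume "P \<in> list_partitions n"
  then have P: "\<Union> (set ` P) = {1..n}" "disjoint (set ` P)" "{} \<notin> set ` P"
      "inj_on set P" "\<forall>\<sigma>\<in>P. distinct \<sigma>"
    by (simp_all add: list_partitions_def partition_on_def)
  have "set \<sigma> \<inter> set \<tau> = {}" if "\<sigma> \<in> P" "\<tau> \<in> P" "\<sigma> \<noteq> \<tau>" for \<sigma> \<tau>
    using that P(2) inj_on_eq_iff[OF P(4)] by (simp add: disjoint_def)
  moreover have "\<sigma> \<noteq> []" if "\<sigma> \<in> P" for \<sigma>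
    using P(3) that by force
  ultimately show ?R using P(1,5) by simp
next
  assume R: ?R
  then have "inj_on set P"
    unfolding inj_on_def by (metis inf.idem set_empty)
  moreover have "disjoint (set ` P)"
    unfolding disjoint_def ball_simps
  proof (intro ballI impI)
    fix \<sigma> \<tau> assume "\<sigma> \<in> P" "\<tau> \<in> P" "set \<sigma> \<noteq> set \<tau>"
    moreover from this have "\<sigma> \<noteq> \<tau>" by auto
    ultimately show "set \<sigma> \<inter> set \<tau> = {}" using R by simp
  qed
  ultimately show "P \<in> list_partitions n"
    using R by (auto simp: list_partitions_def partition_on_def)
qed

lemma list_partitions_disjoint:
  "P \<in> list_partitions n \<Longrightarrow> \<sigma> \<in> P \<Longrightarrow> \<tau> \<in> P \<Longrightarrow> \<sigma> \<noteq> \<tau> \<Longrightarrow> set \<sigma> \<inter> set \<tau> = {}"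
  by (simp add: list_partitions_iff)

lemma list_partitions_range:
  assumes "P \<in> list_partitions n" "\<sigma> \<in> P" "b \<in> set \<sigma>"
  shows "b \<in> {1..n}"
proof -
  have "b \<in> (\<Union>\<sigma>\<in>P. set \<sigma>)" using assms(2,3) by blast
  then show ?thesis using assms(1) by (simp only: list_partitions_iff)
qed

lemma list_partitions_0: "list_partitions 0 = {{}}"
proof -
  have "P = {}" if "P \<in> list_partitions 0" for P
    using that unfolding list_partitions_iff by fastforce
  moreover have "{} \<in> list_partitions 0"
    by (simp add: list_partitions_iff)
  ultimately show ?thesis by blast
qed

section \<open>Adding and removing the largest element\<close>

lemma Suc_notin_list_partition:
  "P \<in> list_partitions n \<Longrightarrow> \<sigma> \<in> P \<Longrightarrow> Suc n \<notin> set \<sigma>"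
  using list_partitions_range[of P n \<sigma> "Suc n"] by auto

lemma insert_singleton_list_partitions:
  assumes "P \<in> list_partitions n"
  shows "insert [Suc n] P \<in> list_partitions (Suc n)"
proof -
  have "{1..Suc n} = insert (Suc n) {1..n}" by auto
  then show ?thesis
    using assms Suc_notin_list_partition[OF assms]
    unfolding list_partitions_iff by auto
qed

lemma remove_singleton_list_partitions:
  assumes "Q \<in> list_partitions (Suc n)" "[Suc n] \<in> Q"
  shows "Q - {[Suc n]} \<in> list_partitions n"
proof -
  have U: "(\<Union>\<sigma>\<in>Q. set \<sigma>) = {1..Suc n}"
    using assms by (simp add: list_partitions_iff)
  have N: "Suc n \<notin> set \<sigma>" if "\<sigma> \<in> Q - {[Suc n]}" for \<sigma>
    using list_partitions_disjoint[OF assms, of \<sigma>] that by auto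
  have "(\<Union>\<sigma>\<in>Q - {[Suc n]}. set \<sigma>) = (\<Union>\<sigma>\<in>Q. set \<sigma>) - {Suc n}"
    using N assms(2) by fastforce
  also have "\<dots> = {1..n}" unfolding U by auto
  finally show ?thesis
    using assms by (auto simp: list_partitions_iff)
qed

lemma insert_at_list_partitions:
  assumes P: "P \<in> list_partitions n" and "\<sigma> \<in> P"
  shows "insert (insert_at (Suc n) i \<sigma>) (P - {\<sigma>}) \<in> list_partitions (Suc n)"
proof -
  have N: "Suc n \<notin> set \<tau>" if "\<tau> \<in> P" for \<tau>
    using that P by (rule Suc_notin_list_partition[rotated])
  have U: "(\<Union>\<tau>\<in>P. set \<tau>) = {1..n}"
    using P by (simp add: list_partitions_iff)
  have "(\<Union>\<tau>\<in>insert (insert_at (Suc n) i \<sigma>) (P - {\<sigma>}). set \<tau>) = insert (Suc n) (\<Union>\<tau>\<in>P. set \<tau>)"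
    using \<open>\<sigma> \<in> P\<close> by auto
  also have "\<dots> = {1..Suc n}" unfolding U by auto
  finally have U': "(\<Union>\<tau>\<in>insert (insert_at (Suc n) i \<sigma>) (P - {\<sigma>}). set \<tau>) = {1..Suc n}" .
  have "insert_at (Suc n) i \<sigma> \<noteq> []" by (simp add: insert_at_def)
  moreover have "set \<sigma> \<inter> set \<tau> = {}" if "\<tau> \<in> P - {\<sigma>}" for \<tau>
    using list_partitions_disjoint[OF assms, of \<tau>] that by auto
  ultimately show ?thesis
    using P N \<open>\<sigma> \<in> P\<close> unfolding list_partitions_iff U'
    by (auto simp: distinct_insert_at)
qed

text \<open>Surjectivity of insertion: delete \<open>Suc n\<close> from the list that contains it.
  That list is not \<open>[Suc n]\<close>, so a nonempty list remains.\<close>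

lemma obtain_insert_at_list_partitions:
  assumes Q: "Q \<in> list_partitions (Suc n)" and "[Suc n] \<notin> Q"
  obtains P \<sigma> i where "P \<in> list_partitions n" "\<sigma> \<in> P" "i \<le> length \<sigma>"
    "Q = insert (insert_at (Suc n) i \<sigma>) (P - {\<sigma>})"
proof -
  have "Suc n \<in> (\<Union>\<tau>\<in>Q. set \<tau>)"
    using Q by (simp add: list_partitions_iff)
  then obtain \<tau> where \<tau>: "\<tau> \<in> Q" "Suc n \<in> set \<tau>" by blast
  then obtain \<sigma> i where \<sigma>: "\<tau> = insert_at (Suc n) i \<sigma>" "i \<le> length \<sigma>"
    using obtain_insert_at by metis
  have "distinct \<tau>" using Q \<tau> by (simp add: list_partitions_iff)
  then have dist: "distinct \<sigma>" "Suc n \<notin> set \<sigma>"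
    by (simp_all add: \<sigma>(1) distinct_insert_at)
  have "\<sigma> \<noteq> []"
    using \<sigma> \<tau>(1) assms(2) by auto
  define R where "R = Q - {\<tau>}"
  have QR: "Q = insert \<tau> R" "\<tau> \<notin> R" using \<tau>(1) by (auto simp: R_def)
  have disjR: "set \<tau> \<inter> set \<rho> = {}" if "\<rho> \<in> R" for \<rho>
    using list_partitions_disjoint[OF Q \<tau>(1)] that by (auto simp: R_def)
  \<comment> \<open>A nonempty part of \<tau> cannot be a list disjoint from \<tau>. Hence removing
    \<sigma> from \<open>insert \<sigma> R\<close> gives back exactly \<open>R\<close>.\<close>
  have "\<sigma> \<notin> R"
    using disjR[of \<sigma>] \<sigma>(1) \<open>\<sigma> \<noteq> []\<close> by auto
  have "(\<Union>\<rho>\<in>insert \<sigma> R. set \<rho>) = (\<Union>\<rho>\<in>Q. set \<rho>) - {Suc n}"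
    using dist(2) disjR by (auto simp: QR(1) \<sigma>(1))
  also have "\<dots> = {1..n}"
    using Q by (auto simp: list_partitions_iff)
  finally have "insert \<sigma> R \<in> list_partitions n"
    using Q disjR dist(1) \<open>\<sigma> \<noteq> []\<close> by (auto simp: list_partitions_iff QR(1) \<sigma>(1))
  moreover have "Q = insert (insert_at (Suc n) i \<sigma>) (insert \<sigma> R - {\<sigma>})"
    using QR(1) \<sigma>(1) \<open>\<sigma> \<notin> R\<close> by simp
  ultimately show thesis
    using that \<sigma>(2) by blast
qed

text \<open>Exactly one list of the result contains \<open>Suc n\<close>. It determines \<sigma> and
  the position, and the other lists are unchanged.\<close>

lemma inj_on_insert_at_list_partitions:
  "inj_on (\<lambda>(P, \<sigma>, i). insert (insert_at (Suc n) i \<sigma>) (P - {\<sigma>}))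
     (SIGMA P:list_partitions n. SIGMA \<sigma>:P. {..length \<sigma>})"
proof -
  have "P = P' \<and> \<sigma> = \<sigma>' \<and> i = i'"
    if P: "P \<in> list_partitions n" "\<sigma> \<in> P" "i \<le> length \<sigma>"
      and P': "P' \<in> list_partitions n" "\<sigma>' \<in> P'" "i' \<le> length \<sigma>'"
      and eq: "insert (insert_at (Suc n) i \<sigma>) (P - {\<sigma>}) = insert (insert_at (Suc n) i' \<sigma>') (P' - {\<sigma>'})"
    for P P' \<sigma> \<sigma>' i i'
  proof -
    let ?\<tau> = "insert_at (Suc n) i \<sigma>" and ?\<tau>' = "insert_at (Suc n) i' \<sigma>'"
    have N: "Suc n \<notin> set \<rho>" if "\<rho> \<in> P \<or> \<rho> \<in> P'" for \<rho>
      using that Suc_notin_list_partition P(1) P'(1) by blast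
    have \<tau>: "Suc n \<in> set ?\<tau>" "Suc n \<in> set ?\<tau>'" by simp_all
    have \<tau>\<tau>': "?\<tau> = ?\<tau>'" using eq N \<tau> by (metis DiffD1 insertE insertI1)
    then have *: "i = i' \<and> \<sigma> = \<sigma>'"
      using insert_at_inject N P P' by metis
    have "?\<tau> \<notin> P - {\<sigma>}" "?\<tau> \<notin> P' - {\<sigma>'}" using N \<tau>(1) by blast+
    then have "P - {\<sigma>} = P' - {\<sigma>'}"
      using eq \<tau>\<tau>' by (metis insert_ident)
    then show ?thesis using * P(2) P'(2) by (metis insert_Diff)
  qed
  then show ?thesis unfolding inj_on_def by auto
qed

section \<open>Recurrence for the generating polynomial\<close>

lemma partition_weight_insert:
  assumes "finite P" "\<sigma> \<notin> P"
  shows "partition_weight x y (insert \<sigma> P) = word_weight x y 0 \<sigma> * partition_weight x y P"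
  using assms by (simp add: partition_weight_def)

text \<open>Partitions of \<open>{1..Suc n}\<close> are split by whether \<open>[Suc n]\<close> is
  one of the lists. If so, this list contributes its weight \<open>x * y\<close>; if not, the
  partition arises from exactly one insertion into a list of a smaller partition.\<close>

lemma sum_partition_weight_Suc:
  "(\<Sum>Q\<in>list_partitions (Suc n). partition_weight x y Q) =
     (\<Sum>P\<in>list_partitions n. x * y * partition_weight x y P +
        (\<Sum>\<sigma>\<in>P. \<Sum>i\<le>length \<sigma>. word_weight x y 0 (insert_at (Suc n) i \<sigma>) * partition_weight x y (P - {\<sigma>})))"
    (is "_ = ?R")
proof -
  let ?w = "partition_weight x y"
  let ?A = "{Q \<in> list_partitions (Suc n). [Suc n] \<in> Q}"
  let ?B = "{Q \<in> list_partitions (Suc n). [Suc n] \<notin> Q}"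
  let ?S = "SIGMA P:list_partitions n. SIGMA \<sigma>:P. {..length \<sigma>}"
  let ?f = "\<lambda>(P, \<sigma>, i). insert (insert_at (Suc n) i \<sigma>) (P - {\<sigma>})"
  have fin: "finite P" if "P \<in> list_partitions n" for P
    using that by (rule finite_in_list_partitions)
  have N: "[Suc n] \<notin> P" if "P \<in> list_partitions n" for P
    using Suc_notin_list_partition[OF that, of "[Suc n]"] by auto
  have "(\<Sum>Q\<in>?A. ?w Q) = (\<Sum>P\<in>list_partitions n. x * y * ?w P)"
  proof (rule sum.reindex_bij_witness[where i = "insert [Suc n]" and j = "\<lambda>Q. Q - {[Suc n]}"])
    fix Q assume Q: "Q \<in> ?A"
    then show "insert [Suc n] (Q - {[Suc n]}) = Q" "Q - {[Suc n]} \<in> list_partitions n"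
      by (auto intro: remove_singleton_list_partitions)
    have "?w Q = ?w (insert [Suc n] (Q - {[Suc n]}))"
      using Q by (auto simp: insert_absorb)
    also have "\<dots> = x * y * ?w (Q - {[Suc n]})"
      using Q by (subst partition_weight_insert) (auto intro: finite_in_list_partitions)
    finally show "x * y * ?w (Q - {[Suc n]}) = ?w Q" by simp
  qed (use N in \<open>auto intro: insert_singleton_list_partitions\<close>)
  moreover have "(\<Sum>Q\<in>?B. ?w Q) =
    (\<Sum>P\<in>list_partitions n. \<Sum>\<sigma>\<in>P. \<Sum>i\<le>length \<sigma>. word_weight x y 0 (insert_at (Suc n) i \<sigma>) * ?w (P - {\<sigma>}))"
  proof -
    have "?B = ?f ` ?S"
    proof
      show "?B \<subseteq> ?f ` ?S"
      proof
        fix Q assume "Q \<in> ?B"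
        then obtain P \<sigma> i where "P \<in> list_partitions n" "\<sigma> \<in> P" "i \<le> length \<sigma>"
          "Q = insert (insert_at (Suc n) i \<sigma>) (P - {\<sigma>})"
          using obtain_insert_at_list_partitions by blast
        then show "Q \<in> ?f ` ?S" by (intro image_eqI[of _ _ "(P, \<sigma>, i)"]) auto
      qed
    next
      \<comment> \<open>Only insertion into the empty list yields a singleton, and no list of a
        partition is empty.\<close>
      have "insert_at (Suc n) i \<sigma> \<noteq> [Suc n]" if "P \<in> list_partitions n" "\<sigma> \<in> P" for P \<sigma> i
      proof
        assume "insert_at (Suc n) i \<sigma> = [Suc n]"
        from arg_cong[OF this, of length] have "\<sigma> = []" by (auto simp: insert_at_def)
        then show False using that by (auto simp: list_partitions_iff)
      qed
      then show "?f ` ?S \<subseteq> ?B"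
        using N by (fastforce intro: insert_at_list_partitions)
    qed
    then have "(\<Sum>Q\<in>?B. ?w Q) = (\<Sum>t\<in>?S. ?w (?f t))"
      using sum.reindex[OF inj_on_insert_at_list_partitions, of ?w n] by simp
    also have "\<dots> = (\<Sum>(P, \<sigma>, i)\<in>?S. word_weight x y 0 (insert_at (Suc n) i \<sigma>) * ?w (P - {\<sigma>}))"
    proof (rule sum.cong[OF refl], clarify)
      fix P \<sigma> i assume P: "P \<in> list_partitions n" "\<sigma> \<in> P"
      have "insert_at (Suc n) i \<sigma> \<notin> P - {\<sigma>}"
        using Suc_notin_list_partition[OF P(1)] by fastforce
      then show "?w (insert (insert_at (Suc n) i \<sigma>) (P - {\<sigma>})) =
          word_weight x y 0 (insert_at (Suc n) i \<sigma>) * ?w (P - {\<sigma>})"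
        using fin[OF P(1)] by (simp add: partition_weight_insert)
    qed
    also have "\<dots> = (\<Sum>P\<in>list_partitions n. \<Sum>(\<sigma>, i)\<in>(SIGMA \<sigma>:P. {..length \<sigma>}).
        word_weight x y 0 (insert_at (Suc n) i \<sigma>) * ?w (P - {\<sigma>}))"
      by (subst sum.Sigma) (auto simp: finite_list_partitions fin)
    also have "\<dots> = (\<Sum>P\<in>list_partitions n. \<Sum>\<sigma>\<in>P. \<Sum>i\<le>length \<sigma>.
        word_weight x y 0 (insert_at (Suc n) i \<sigma>) * ?w (P - {\<sigma>}))"
      by (rule sum.cong[OF refl]) (simp add: sum.Sigma fin)
    finally show ?thesis .
  qed
  moreover have "(\<Sum>Q\<in>list_partitions (Suc n). ?w Q) = (\<Sum>Q\<in>?A. ?w Q) + (\<Sum>Q\<in>?B. ?w Q)"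
  proof -
    have "list_partitions (Suc n) = ?A \<union> ?B" by blast
    moreover have "sum ?w (?A \<union> ?B) = sum ?w ?A + sum ?w ?B"
      by (rule sum.union_disjoint) (auto simp: finite_list_partitions)
    ultimately show ?thesis by simp
  qed
  ultimately show ?thesis by (simp add: sum.distrib)
qed

section \<open>Reading off the coefficients\<close>

lemma sum_length_list_partition:
  assumes "P \<in> list_partitions n"
  shows "(\<Sum>\<sigma>\<in>P. length \<sigma>) = n"
proof -
  have "(\<Sum>\<sigma>\<in>P. length \<sigma>) = (\<Sum>\<sigma>\<in>P. card (set \<sigma>))"
    using assms by (intro sum.cong) (auto simp: list_partitions_iff distinct_card)
  also have "\<dots> = card (\<Union>\<sigma>\<in>P. set \<sigma>)"
    using assms finite_in_list_partitions[OF assms]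
    by (intro card_UN_disjoint[symmetric]) (auto simp: list_partitions_iff)
  also have "\<dots> = n"
    using assms by (simp add: list_partitions_iff)
  finally show ?thesis .
qed

lemma ascents_le:
  assumes "P \<in> list_partitions n"
  shows "ascents P \<le> n"
  using sum_mono[of P list_ascents length] list_ascents_le_length
  by (simp add: ascents_def sum_length_list_partition[OF assms])

lemma card_le_ascents:
  assumes "P \<in> list_partitions n"
  shows "card P \<le> ascents P"
proof -
  have "0 \<notin> set \<sigma>" if "\<sigma> \<in> P" for \<sigma>
    using list_partitions_range[OF assms that, of 0] by auto
  then have "(\<Sum>\<sigma>\<in>P. 1) \<le> (\<Sum>\<sigma>\<in>P. list_ascents \<sigma>)"
    using assms by (intro sum_mono list_ascents_pos) (auto simp: list_partitions_iff)
  then show ?thesis by (simp add: ascents_def)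
qed

text \<open>A list has one gap more than it has letters, so there are \<open>card P + n\<close> gaps
  in all; those that do not ascend carry \<open>y\<close>.\<close>

lemma partition_weight_eq:
  assumes "P \<in> list_partitions n"
  shows "partition_weight x y P = x ^ ascents P * y ^ (card P + n - ascents P)"
proof -
  have "(\<Sum>\<sigma>\<in>P. Suc (length \<sigma>) - list_ascents \<sigma>) = (\<Sum>\<sigma>\<in>P. Suc (length \<sigma>)) - ascents P"
    \<comment> \<open>Natural subtraction commutes with the sum because no list has more ascents
      than gaps.\<close>
    unfolding ascents_def by (rule sum_subtractf_nat) (simp add: le_SucI list_ascents_le_length)
  also have "(\<Sum>\<sigma>\<in>P. Suc (length \<sigma>)) = card P + n"
    using sum.distrib[of "\<lambda>_. 1" length P] sum_length_list_partition[OF assms] by simp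
  finally show ?thesis
    by (simp add: partition_weight_def word_weight_0 prod.distrib ascents_def flip: power_sum)
qed

text \<open>Group the partitions by number of lists and number of ascents. The bounds
  \<open>card P \<le> ascents P\<close> and \<open>ascents P \<le> n\<close> give the triangular
  range.\<close>

lemma sum_partition_weight_eq:
  assumes "n \<ge> 1"
  shows "(\<Sum>P\<in>list_partitions n. partition_weight x y P) =
    (\<Sum>k=1..n. \<Sum>m=k..n. of_nat (C n k m) * x ^ m * y ^ (k + n - m))"
proof -
  let ?T = "SIGMA k:{1..n}. {k..n}"
  have "(\<Sum>P\<in>list_partitions n. partition_weight x y P) =
      (\<Sum>t\<in>?T. \<Sum>P | P \<in> list_partitions n \<and> (card P, ascents P) = t. partition_weight x y P)"
  proof (rule sum.group[symmetric])
    have "card P \<ge> 1" if "P \<in> list_partitions n" for P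
    proof -
      \<comment> \<open>Here \<open>n \<ge> 1\<close> enters: the empty partition of the empty set
        would give \<open>k = 0\<close>.\<close>
      have "P \<noteq> {}" using that assms by (auto simp: list_partitions_iff)
      then show ?thesis
        using finite_in_list_partitions[OF that] by (simp add: Suc_le_eq card_gt_0_iff)
    qed
    then show "(\<lambda>P. (card P, ascents P)) ` list_partitions n \<subseteq> ?T"
      using ascents_le card_le_ascents by (fastforce intro: order_trans)
  qed (auto simp: finite_list_partitions)
  also have "\<dots> = (\<Sum>(k, m)\<in>?T. of_nat (C n k m) * x ^ m * y ^ (k + n - m))"
  proof (rule sum.cong[OF refl], clarify)
    fix k m
    have "(\<Sum>P | P \<in> list_partitions n \<and> (card P, ascents P) = (k, m). partition_weight x y P) =
        (\<Sum>P | P \<in> list_partitions n \<and> card P = k \<and> ascents P = m. x ^ m * y ^ (k + n - m))"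
      by (rule sum.cong) (auto simp: partition_weight_eq)
    then show "(\<Sum>P | P \<in> list_partitions n \<and> (card P, ascents P) = (k, m). partition_weight x y P) =
        of_nat (C n k m) * x ^ m * y ^ (k + n - m)"
      by (simp add: C_def mult.assoc)
  qed
  also have "\<dots> = (\<Sum>k=1..n. \<Sum>m=k..n. of_nat (C n k m) * x ^ m * y ^ (k + n - m))"
    by (simp add: sum.Sigma)
  finally show ?thesis .
qed


section \<open>The derivation\<close>

text \<open>An arbitrary commutative ring with a map obeying the Leibniz rule keeps the
  representation of polynomials out of the computation.\<close>

locale lists_derivation =
  fixes D :: "'r::comm_ring_1 \<Rightarrow> 'r" and x y z :: 'r
  assumes D_add: "D (p + q) = D p + D q"
    and D_mult: "D (p * q) = D p * q + p * D q"
    and D_x: "D x = x * y" and D_y: "D y = x * y" and D_z: "D z = x * y * z"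
begin

lemma D_0: "D 0 = 0"
  using D_add[of 0 0] by simp

lemma D_1: "D 1 = 0"
  using D_mult[of 1 1] by simp

lemma D_sum: "D (\<Sum>i\<in>A. f i) = (\<Sum>i\<in>A. D (f i))"
  by (induction A rule: infinite_finite_induct) (simp_all add: D_0 D_add)

lemma D_prod: "finite A \<Longrightarrow> D (\<Prod>i\<in>A. f i) = (\<Sum>i\<in>A. D (f i) * (\<Prod>j\<in>A - {i}. f j))"
proof (induction A rule: finite_induct)
  case empty
  then show ?case by (simp add: D_1)
next
  case (insert a A)
  have "(\<Sum>i\<in>A. D (f i) * (\<Prod>j\<in>insert a A - {i}. f j)) =
      (\<Sum>i\<in>A. f a * (D (f i) * (\<Prod>j\<in>A - {i}. f j)))"
  proof (rule sum.cong[OF refl])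
    fix i assume "i \<in> A"
    then have "insert a A - {i} = insert a (A - {i})" using insert.hyps(2) by auto
    then show "D (f i) * (\<Prod>j\<in>insert a A - {i}. f j) = f a * (D (f i) * (\<Prod>j\<in>A - {i}. f j))"
      using insert.hyps by (simp add: mult.left_commute)
  qed
  then show ?case
    using insert by (simp add: D_mult sum_distrib_left)
qed

text \<open>The Leibniz rule differentiates one gap at a time, and position \<open>i\<close> of the
  insertion corresponds to gap \<open>i\<close>. Since \<open>N\<close> exceeds every letter and
  \<open>a\<close>, the gap becomes an ascent to \<open>N\<close> and a descent from it, of weight
  \<open>x * y\<close>.\<close>

lemma D_word_weight:
  assumes "a < N" "\<And>b. b \<in> set s \<Longrightarrow> b < N"
  shows "D (word_weight x y a s) = (\<Sum>i\<le>length s. word_weight x y a (insert_at N i s))"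
  using assms
proof (induction s arbitrary: a)
  case Nil
  then show ?case by (simp add: D_y)
next
  case (Cons b s)
  \<comment> \<open>Both letters have the same derivative, so it does not matter whether the gap
    ascended.\<close>
  have "D (if a < b then x else y) = x * y" by (simp add: D_x D_y)
  moreover have "b < N" "\<not> N < b" using Cons.prems(2)[of b] by simp_all
  ultimately show ?case
    using Cons
    \<comment> \<open>Shifting the sum separates insertion before \<open>b\<close>, which breaks the
      first gap, from insertions after \<open>b\<close>, which the induction hypothesis
      covers.\<close>
    by (simp add: D_mult sum.atMost_Suc_shift sum_distrib_left mult.assoc
        del: sum.atMost_Suc)
qed

lemma D_funpow_z: "(D ^^ n) z = (\<Sum>P\<in>list_partitions n. partition_weight x y P) * z"
proof (induction n)
  case 0
  \<comment> \<open>The empty partition has the empty product \<open>1\<close> as its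
    weight.\<close>
  then show ?case by (simp add: list_partitions_0 partition_weight_def)
next
  case (Suc n)
  let ?w = "partition_weight x y"
  have D_weight: "D (?w P) =
      (\<Sum>\<sigma>\<in>P. \<Sum>i\<le>length \<sigma>. word_weight x y 0 (insert_at (Suc n) i \<sigma>) * ?w (P - {\<sigma>}))"
    if P: "P \<in> list_partitions n" for P
  proof -
    have "D (word_weight x y 0 \<sigma>) = (\<Sum>i\<le>length \<sigma>. word_weight x y 0 (insert_at (Suc n) i \<sigma>))"
      if "\<sigma> \<in> P" for \<sigma>
      using list_partitions_range[OF P that] by (intro D_word_weight) (auto simp: less_Suc_eq_le)
    then show ?thesis
      using finite_in_list_partitions[OF P]
      by (simp add: partition_weight_def D_prod sum_distrib_right)
  qed
  \<comment> \<open>In the derivative of each product \<open>?w P * z\<close>, the factor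
    \<open>z\<close> gives the term for a new list and \<open>?w P\<close> gives the
    insertions.\<close>
  have "(D ^^ Suc n) z = (\<Sum>P\<in>list_partitions n. x * y * ?w P + D (?w P)) * z"
    by (simp add: Suc D_mult D_sum D_z sum.distrib sum_distrib_left sum_distrib_right algebra_simps)
  also have "\<dots> = (\<Sum>Q\<in>list_partitions (Suc n). ?w Q) * z"
    by (simp add: sum_partition_weight_Suc D_weight)
  finally show ?case .
qed

end

section \<open>The formal derivative of the grammar as an instance\<close>

theorem theorem2p4:
  fixes n :: nat
  assumes "n \<ge> 1"
  shows "(formal_derivative lists_grammar ^^ n) (letter Z :: (xyz, 'a::comm_ring_1) polynomial) =
    (\<Sum>k=1..n. \<Sum>m=k..n.
       of_nat (C n k m) * letter X ^ m * letter Y ^ (k + n - m) * letter Z)"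
proof -
  let ?D = "formal_derivative lists_grammar :: (xyz, 'a) polynomial \<Rightarrow> (xyz, 'a) polynomial"
  have D: "is_formal_derivative lists_grammar ?D"
    by (rule is_formal_derivative_formal_derivative)
  \<comment> \<open>This supplies \<open>add\<close>, the additivity that
    \<open>lists_derivation\<close> asks for.\<close>
  interpret module_hom poly_scale poly_scale ?D
    using D by (simp add: is_formal_derivative_def)
  interpret lists_derivation ?D "letter X" "letter Y" "letter Z"
    using D by unfold_locales (simp_all add: add is_formal_derivative_def)
  show ?thesis
    by (simp add: D_funpow_z sum_partition_weight_eq[OF assms] sum_distrib_right)
qed

end
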